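(* Every labelled sequent derivable in the calculus $\mathsf{G3Ldm}$ is valid.
   Context: Fix a finite set of agents $Ag=\{1,\dots,n\}$ and a countable set $Var$ of propositional variables. $\mathcal{L}_{\mathsf{Ldm}}$ (negation normal form): $\phi ::= p \mid \overline{p} \mid \phi\wedge\phi \mid \phi\vee\phi \mid \Box\phi \mid \Diamond\phi \mid [i]\phi \mid \langle i\rangle\phi$, $p\in Var$, $i\in Ag$. A $\mathsf{Tstit}$-model is $(W,\mathcal{R}_\Box,\{\mathcal{R}_i\}_{i\in Ag},\mathcal{R}_{Ag},\mathcal{R}_{\mathsf G},\mathcal{R}_{\mathsf H},V)$ with $W\ne\emptyset$, $V:Var\to\mathcal P(W)$, $\mathcal{R}_\Box,\mathcal{R}_i,\mathcal{R}_{Ag}$ equivalence relations, and (C1) $\mathcal{R}_i\subseteq\mathcal{R}_\Box$; (C2) for all $u_1,\dots,u_n$ pairwise $\mathcal{R}_\Box$-related, $\bigcap_i\mathcal{R}_i(u_i)\neq\emptyset$ (where $\mathcal R(w)=\{v:(w,v)\in\mathcal R\}$); (C3) $\mathcal{R}_{Ag}(w)=\bigcap_{i}\mathcal{R}_i(w)$; $\mathcal{R}_{\mathsf G}$ transitive and serial, $\mathcal{R}_{\mathsf H}$ its converse; (C4) if $\mathcal{R}_{\mathsf G}wu,\mathcal{R}_{\mathsf G}wv$ then $\mathcal{R}_{\mathsf G}uv$ or $u=v$ or $\mathcal{R}_{\mathsf G}vu$; (C5) same for $\mathcal{R}_{\mathsf H}$; (C6) $\mathcal{R}_{\mathsf G}\circ\mathcal{R}_\Box\subseteq\mathcal{R}_{Ag}\circ\mathcal{R}_{\mathsf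 G}$; (C7) $u\in\mathcal{R}_\Box(w)$ implies $u\notin\mathcal{R}_{\mathsf G}(w)$. Satisfaction: $w\models p$ iff $w\in V(p)$; $w\models\overline p$ iff $w\notin V(p)$; $\wedge,\vee$ classical; $\Box$/$\Diamond$ are universal/existential over $\mathcal{R}_\Box(w)$; $[i]$/$\langle i\rangle$ over $\mathcal{R}_i(w)$. Labelled sequents: $\Gamma ::= x:\phi \mid \Gamma,\Gamma \mid \mathcal{R}_\alpha xy,\Gamma$ (multisets), with labels from a countable set $L$, $\phi\in\mathcal L_{\mathsf{Ldm}}$, $\alpha\in\{\Box\}\cup Ag$. Rules of $\mathsf{G3Ldm}$ (one-sided): (id) $\Gamma,w:p,w:\overline p$ is an axiom; ($\wedge$) from $\Gamma,w:\phi$ and $\Gamma,w:\psi$ infer $\Gamma,w:\phi\wedge\psi$; ($\vee$) from $\Gamma,w:\phi,w:\psi$ infer $\Gamma,w:\phi\vee\psi$; ($\Box$) from $\Gamma,\mathcal R_\Box wv,v:\phi$ infer $\Gamma,w:\Box\phi$; ($\Diamond$) from $\Gamma,\mathcal R_\Box wu,w:\Diamond\phi,u:\phi$ infer $\Gamma,\mathcal R_\Box wu,w:\Diamond\phi$; ($[i]$) from $\Gamma,\mathcal R_i wv,v:\phi$ infer $\Gamma,w:[i]\phi$; ($\langle i\rangle$) from $\Gamma,\mathcal R_iwu,w:\langle i\rangle\phi,u:\phi$ infer $\Gamma,\mathcal R_iwu,w:\langle i\rangle\phi$; ($\mathsf{refl}_\Box$) from $\mathcal R_\Box ww,\Gamma$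 infer $\Gamma$; ($\mathsf{refl}_{[i]}$) from $\mathcal R_iww,\Gamma$ infer $\Gamma$; ($\mathsf{IOA}$) from $\mathcal R_\Box wu_1,\dots,\mathcal R_\Box wu_n,\mathcal R_1u_1v,\dots,\mathcal R_nu_nv,\Gamma$ infer $\mathcal R_\Box wu_1,\dots,\mathcal R_\Box wu_n,\Gamma$; ($\mathsf{eucl}_\Box$) from $\mathcal R_\Box wu,\mathcal R_\Box wv,\mathcal R_\Box uv,\Gamma$ infer $\mathcal R_\Box wu,\mathcal R_\Box wv,\Gamma$; ($\mathsf{br}_{[i]}$) from $\mathcal R_\Box wu,\mathcal R_iwu,\Gamma$ infer $\mathcal R_iwu,\Gamma$; ($\mathsf{eucl}_{[i]}$) from $\mathcal R_iwu,\mathcal R_iwv,\mathcal R_iuv,\Gamma$ infer $\mathcal R_iwu,\mathcal R_iwv,\Gamma$. In ($\Box$), ($[i]$), ($\mathsf{IOA}$) the label $v$ must not occur in the conclusion. The calculus also contains, for each rule where a substitution of labels duplicates active relational atoms, the instance with the duplicates contracted. Interpretation: for a $\mathsf{Tstit}$-model $M$ and a map $I:L\to W$, a sequent $\Gamma$ is satisfied in $M$ under $I$ iff, whenever $\mathcal R_\alpha I(x)I(y)$ holds in $M$ for every relational atom $\mathcal R_\alpha xy$ in $\Gamma$, there is some $z:\phi$ in $\Gamma$ with $M,I(z)\models\phi$. $\Gamma$ is valid iff it is satisfied in every such model under every $I$. *)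

theory Defs
  imports "HOL-Library.Multiset" "HOL-Library.Countable"
begin

text \<open>The finite set of agents is rendered as a type variable \<open>'ag\<close> of class \<open>finite\<close>
  (so \<open>n = CARD('ag)\<close>), with \<open>i :: 'ag\<close> ranging over all agents.\<close>

datatype ('v, 'ag) fm =
    Atom 'v
  | NegAtom 'v
  | And "('v, 'ag) fm" "('v, 'ag) fm"
  | Or "('v, 'ag) fm" "('v, 'ag) fm"
  | Box "('v, 'ag) fm"
  | Dia "('v, 'ag) fm"
  | AgBox 'ag "('v, 'ag) fm"
  | AgDia 'ag "('v, 'ag) fm"

record ('w, 'v, 'ag) tstit =
  worlds :: "'w set"
  Rbox :: "('w \<times> 'w) set"
  Rag :: "'ag \<Rightarrow> ('w \<times> 'w) set"
  RAg :: "('w \<times> 'w) set"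
  RG :: "('w \<times> 'w) set"
  RH :: "('w \<times> 'w) set"
  val :: "'v \<Rightarrow> 'w set"

text \<open>In \<open>C6\<close>, composition is read from left to right, as \<^const>\<open>relcomp\<close> does: if \<open>w\<close> sees \<open>u\<close> in its
  future and \<open>v\<close> lies in the same moment as \<open>u\<close>, then \<open>v\<close> is in the future of some \<open>z\<close> lying in
  the same choice cell of the grand coalition as \<open>w\<close> (no choice between undivided histories).\<close>

locale tstit_model =
  fixes M :: "('w, 'v, 'ag::finite) tstit"
  assumes worlds_nonempty: "worlds M \<noteq> {}"
    and val_worlds: "val M p \<subseteq> worlds M"
    and equiv_box: "equiv (worlds M) (Rbox M)"
    and equiv_ag: "equiv (worlds M) (Rag M i)"
    and equiv_Ag: "equiv (worlds M) (RAg M)"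
    and C1: "Rag M i \<subseteq> Rbox M"
    and C2: "\<lbrakk>\<And>j. us j \<in> worlds M; \<And>j k. (us j, us k) \<in> Rbox M\<rbrakk>
              \<Longrightarrow> (\<Inter>j. Rag M j `` {us j}) \<noteq> {}"
    and C3: "w \<in> worlds M \<Longrightarrow> RAg M `` {w} = (\<Inter>j. Rag M j `` {w})"
    and RG_worlds: "RG M \<subseteq> worlds M \<times> worlds M"
    and RG_trans: "trans (RG M)"
    and RG_serial: "w \<in> worlds M \<Longrightarrow> \<exists>u. (w, u) \<in> RG M"
    and RH_converse: "RH M = (RG M)\<inverse>"
    and C4: "\<lbrakk>(w, u) \<in> RG M; (w, v) \<in> RG M\<rbrakk> \<Longrightarrow> (u, v) \<in> RG M \<or> u = v \<or> (v, u) \<in> RG M"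
    and C5: "\<lbrakk>(w, u) \<in> RH M; (w, v) \<in> RH M\<rbrakk> \<Longrightarrow> (u, v) \<in> RH M \<or> u = v \<or> (v, u) \<in> RH M"
    and C6: "RG M O Rbox M \<subseteq> RAg M O RG M"
    and C7: "u \<in> Rbox M `` {w} \<Longrightarrow> u \<notin> RG M `` {w}"

primrec sat :: "('w, 'v, 'ag) tstit \<Rightarrow> 'w \<Rightarrow> ('v, 'ag) fm \<Rightarrow> bool" where
  "sat M w (Atom p) \<longleftrightarrow> w \<in> val M p"
| "sat M w (NegAtom p) \<longleftrightarrow> w \<notin> val M p"
| "sat M w (And \<phi> \<psi>) \<longleftrightarrow> sat M w \<phi> \<and> sat M w \<psi>"
| "sat M w (Or \<phi> \<psi>) \<longleftrightarrow> sat M w \<phi> \<or> sat M w \<psi>"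
| "sat M w (Box \<phi>) \<longleftrightarrow> (\<forall>u \<in> Rbox M `` {w}. sat M u \<phi>)"
| "sat M w (Dia \<phi>) \<longleftrightarrow> (\<exists>u \<in> Rbox M `` {w}. sat M u \<phi>)"
| "sat M w (AgBox i \<phi>) \<longleftrightarrow> (\<forall>u \<in> Rag M i `` {w}. sat M u \<phi>)"
| "sat M w (AgDia i \<phi>) \<longleftrightarrow> (\<exists>u \<in> Rag M i `` {w}. sat M u \<phi>)"

datatype 'ag idx = IBox | IAg 'ag

primrec rel_of :: "('w, 'v, 'ag) tstit \<Rightarrow> 'ag idx \<Rightarrow> ('w \<times> 'w) set" where
  "rel_of M IBox = Rbox M"
| "rel_of M (IAg i) = Rag M i"

datatype ('l, 'v, 'ag) item =
    Lab 'l "('v, 'ag) fm"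
  | Rel "'ag idx" 'l 'l

type_synonym ('l, 'v, 'ag) sequent = "('l, 'v, 'ag) item multiset"

primrec item_labels :: "('l, 'v, 'ag) item \<Rightarrow> 'l set" where
  "item_labels (Lab x \<phi>) = {x}"
| "item_labels (Rel \<alpha> x y) = {x, y}"

definition labels :: "('l, 'v, 'ag) sequent \<Rightarrow> 'l set" where
  "labels \<Gamma> = (\<Union>a \<in> set_mset \<Gamma>. item_labels a)"

text \<open>The rules \<open>IOA_contr\<close>, \<open>eucl_box_contr\<close> and \<open>eucl_ag_contr\<close> are the instances whose
  duplicated principal relational atoms are contracted: in \<open>IOA\<close> when some of the labels
  \<open>u i\<close> coincide (hence the multiset of the \<^emph>\<open>set\<close> of atoms), in the Euclidean rules when the labels
  \<open>u\<close> and \<open>v\<close> coincide. Identifying labels of a Euclidean rule can also duplicate the atom added in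
  the premise, but contracting it makes premise and conclusion equal, so this yields no further rule.\<close>

inductive G3Ldm :: "('l, 'v, 'ag::finite) sequent \<Rightarrow> bool" where
  id: "G3Ldm (\<Gamma> + {#Lab w (Atom p), Lab w (NegAtom p)#})"
| conj: "\<lbrakk>G3Ldm (\<Gamma> + {#Lab w \<phi>#}); G3Ldm (\<Gamma> + {#Lab w \<psi>#})\<rbrakk>
    \<Longrightarrow> G3Ldm (\<Gamma> + {#Lab w (And \<phi> \<psi>)#})"
| disj: "G3Ldm (\<Gamma> + {#Lab w \<phi>, Lab w \<psi>#}) \<Longrightarrow> G3Ldm (\<Gamma> + {#Lab w (Or \<phi> \<psi>)#})"
| box: "\<lbrakk>G3Ldm (\<Gamma> + {#Rel IBox w v, Lab v \<phi>#}); v \<notin> labels (\<Gamma> + {#Lab w (Box \<phi>)#})\<rbrakk>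
    \<Longrightarrow> G3Ldm (\<Gamma> + {#Lab w (Box \<phi>)#})"
| dia: "G3Ldm (\<Gamma> + {#Rel IBox w u, Lab w (Dia \<phi>), Lab u \<phi>#})
    \<Longrightarrow> G3Ldm (\<Gamma> + {#Rel IBox w u, Lab w (Dia \<phi>)#})"
| ag_box: "\<lbrakk>G3Ldm (\<Gamma> + {#Rel (IAg i) w v, Lab v \<phi>#}); v \<notin> labels (\<Gamma> + {#Lab w (AgBox i \<phi>)#})\<rbrakk>
    \<Longrightarrow> G3Ldm (\<Gamma> + {#Lab w (AgBox i \<phi>)#})"
| ag_dia: "G3Ldm (\<Gamma> + {#Rel (IAg i) w u, Lab w (AgDia i \<phi>), Lab u \<phi>#})
    \<Longrightarrow> G3Ldm (\<Gamma> + {#Rel (IAg i) w u, Lab w (AgDia i \<phi>)#})"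
| refl_box: "G3Ldm ({#Rel IBox w w#} + \<Gamma>) \<Longrightarrow> G3Ldm \<Gamma>"
| refl_ag: "G3Ldm ({#Rel (IAg i) w w#} + \<Gamma>) \<Longrightarrow> G3Ldm \<Gamma>"
| IOA: "\<lbrakk>G3Ldm ({#Rel IBox w (u i). i \<in># mset_set UNIV#}
                + {#Rel (IAg i) (u i) v. i \<in># mset_set UNIV#} + \<Gamma>);
         v \<notin> labels ({#Rel IBox w (u i). i \<in># mset_set UNIV#} + \<Gamma>)\<rbrakk>
    \<Longrightarrow> G3Ldm ({#Rel IBox w (u i). i \<in># mset_set UNIV#} + \<Gamma>)"
| IOA_contr: "\<lbrakk>G3Ldm (mset_set (range (\<lambda>i. Rel IBox w (u i)))
                + {#Rel (IAg i) (u i) v. i \<in># mset_set UNIV#} + \<Gamma>);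
         v \<notin> labels (mset_set (range (\<lambda>i. Rel IBox w (u i))) + \<Gamma>)\<rbrakk>
    \<Longrightarrow> G3Ldm (mset_set (range (\<lambda>i. Rel IBox w (u i))) + \<Gamma>)"
| eucl_box: "G3Ldm ({#Rel IBox w u, Rel IBox w v, Rel IBox u v#} + \<Gamma>)
    \<Longrightarrow> G3Ldm ({#Rel IBox w u, Rel IBox w v#} + \<Gamma>)"
| eucl_box_contr: "G3Ldm ({#Rel IBox w u, Rel IBox u u#} + \<Gamma>) \<Longrightarrow> G3Ldm ({#Rel IBox w u#} + \<Gamma>)"
| br: "G3Ldm ({#Rel IBox w u, Rel (IAg i) w u#} + \<Gamma>) \<Longrightarrow> G3Ldm ({#Rel (IAg i) w u#} + \<Gamma>)"
| eucl_ag: "G3Ldm ({#Rel (IAg i) w u, Rel (IAg i) w v, Rel (IAg i) u v#} + \<Gamma>)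
    \<Longrightarrow> G3Ldm ({#Rel (IAg i) w u, Rel (IAg i) w v#} + \<Gamma>)"
| eucl_ag_contr: "G3Ldm ({#Rel (IAg i) w u, Rel (IAg i) u u#} + \<Gamma>)
    \<Longrightarrow> G3Ldm ({#Rel (IAg i) w u#} + \<Gamma>)"

text \<open>Sequents are meant to contain at least one labelled formula. The type does not enforce
  this, but every derivable multiset satisfies it.\<close>

lemma G3Ldm_has_formula: "G3Ldm \<Gamma> \<Longrightarrow> \<exists>x \<phi>. Lab x \<phi> \<in># \<Gamma>"
  by (induction rule: G3Ldm.induct) auto

definition satisfied ::
    "('w, 'v, 'ag) tstit \<Rightarrow> ('l \<Rightarrow> 'w) \<Rightarrow> ('l, 'v, 'ag) sequent \<Rightarrow> bool" where
  "satisfied M I \<Gamma> \<longleftrightarrow>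
     ((\<forall>\<alpha> x y. Rel \<alpha> x y \<in># \<Gamma> \<longrightarrow> (I x, I y) \<in> rel_of M \<alpha>) \<longrightarrow>
      (\<exists>z \<phi>. Lab z \<phi> \<in># \<Gamma> \<and> sat M (I z) \<phi>))"

text \<open>HOL cannot quantify over types inside a formula, so validity is relative to a type \<open>'w\<close>
  from which the worlds of models are drawn. A theorem in which \<open>'w\<close> is a type variable
  covers models over arbitrary sets of worlds.\<close>

definition valid :: "'w itself \<Rightarrow> ('l, 'v, 'ag::finite) sequent \<Rightarrow> bool" where
  "valid (_ :: 'w itself) \<Gamma> \<longleftrightarrow>
     (\<forall>(M :: ('w, 'v, 'ag) tstit) I.
        tstit_model M \<longrightarrow> (\<forall>x. I x \<in> worlds M) \<longrightarrow> satisfied M I \<Gamma>)"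

end

theory Submission
  imports Defs
begin

text \<open>A sequent is read as a disjunction in which a relational atom contributes its negation.
  A rule then preserves satisfaction because its active formulas are semantically entailed or its
  active atoms express a property of the model's relations; for a rule with an eigenvariable, the
  eigenvariable is reinterpreted as a suitable witness, which for \<open>IOA\<close> is supplied by
  independence of agents (C2).\<close>

primrec holds :: "('w, 'v, 'ag) tstit \<Rightarrow> ('l \<Rightarrow> 'w) \<Rightarrow> ('l, 'v, 'ag) item \<Rightarrow> bool" where
  "holds M I (Lab x \<phi>) \<longleftrightarrow> sat M (I x) \<phi>"
| "holds M I (Rel \<alpha> x y) \<longleftrightarrow> (I x, I y) \<notin> rel_of M \<alpha>"

text \<open>The implication from atoms to formulas becomes one disjunction over items, so
  satisfaction distributes over \<open>add_mset\<close> and \<open>+\<close>, and most rules reduce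
  to propositional reasoning.\<close>

lemma satisfied_iff: "satisfied M I \<Gamma> \<longleftrightarrow> (\<exists>a \<in># \<Gamma>. holds M I a)"
proof
  assume "satisfied M I \<Gamma>"
  then show "\<exists>a \<in># \<Gamma>. holds M I a"
    unfolding satisfied_def by (metis holds.simps)
next
  assume "\<exists>a \<in># \<Gamma>. holds M I a"
  then obtain a where "a \<in># \<Gamma>" "holds M I a" by blast
  then show "satisfied M I \<Gamma>"
    unfolding satisfied_def by (cases a) auto
qed

lemma satisfied_empty [simp]: "\<not> satisfied M I {#}"
  by (simp add: satisfied_iff)

lemma satisfied_add_mset [simp]:
  "satisfied M I (add_mset a \<Gamma>) \<longleftrightarrow> holds M I a \<or> satisfied M I \<Gamma>"
  by (auto simp: satisfied_iff)

lemma satisfied_union [simp]: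
  "satisfied M I (\<Gamma> + \<Delta>) \<longleftrightarrow> satisfied M I \<Gamma> \<or> satisfied M I \<Delta>"
  by (auto simp: satisfied_iff)

lemma satisfied_image_mset_set [simp]:
  "finite A \<Longrightarrow> satisfied M I (image_mset f (mset_set A)) \<longleftrightarrow> (\<exists>i \<in> A. holds M I (f i))"
  by (simp add: satisfied_iff)

lemma holds_fun_upd: "v \<notin> item_labels a \<Longrightarrow> holds M (I(v := x)) a \<longleftrightarrow> holds M I a"
  by (cases a) auto

text \<open>What freshness buys: an eigenvariable can be sent to another world without changing the
  status of the conclusion.\<close>

lemma satisfied_fun_upd: "v \<notin> labels \<Gamma> \<Longrightarrow> satisfied M (I(v := x)) \<Gamma> \<longleftrightarrow> satisfied M I \<Gamma>"
  unfolding satisfied_iff labels_def by (meson UN_I holds_fun_upd)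

context tstit_model
begin

lemma equiv_rel_of: "equiv (worlds M) (rel_of M \<alpha>)"
  by (cases \<alpha>) (simp_all add: equiv_box equiv_ag)

lemma rel_of_worlds: "(a, b) \<in> rel_of M \<alpha> \<Longrightarrow> b \<in> worlds M"
  using equiv_rel_of[of \<alpha>] by (auto simp: equiv_def)

lemma rel_of_refl: "a \<in> worlds M \<Longrightarrow> (a, a) \<in> rel_of M \<alpha>"
  using equiv_rel_of[of \<alpha>] by (auto simp: equiv_def refl_on_def)

lemma rel_of_eucl:
  "(a, b) \<in> rel_of M \<alpha> \<Longrightarrow> (a, c) \<in> rel_of M \<alpha> \<Longrightarrow> (b, c) \<in> rel_of M \<alpha>"
  using equiv_rel_of[of \<alpha>] unfolding equiv_def by (meson symE transE)

lemma independence_of_agents: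
  assumes "\<And>i. (a, us i) \<in> Rbox M"
  obtains b where "b \<in> worlds M" "\<And>i. (us i, b) \<in> Rag M i"
proof -
  have "us j \<in> worlds M" for j
    using assms[of j] rel_of_worlds[of a "us j" IBox] by simp
  \<comment> \<open>\<open>C2\<close> asks for pairwise related worlds; being seen from the common
    world \<open>a\<close> gives this by the Euclidean property.\<close>
  moreover have "(us j, us k) \<in> Rbox M" for j k
    using assms rel_of_eucl[of a "us j" IBox "us k"] by simp
  ultimately have "(\<Inter>i. Rag M i `` {us i}) \<noteq> {}"
    by (intro C2)
  then obtain b where b: "(us i, b) \<in> Rag M i" for i
    by blast
  \<comment> \<open>\<open>undefined\<close> is just some agent, as every type is inhabited; lying
    in one choice cell already places \<open>b\<close> among the worlds.\<close>
  then have "b \<in> worlds M"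
    using rel_of_worlds[of "us undefined" b "IAg undefined"] by simp
  with b show thesis using that by blast
qed

text \<open>The common core of the rules for \<open>Box\<close> and \<open>AgBox\<close>. Send
  \<open>v\<close> to \<open>b\<close>: by freshness \<open>\<Gamma>\<close> stays unsatisfied, and
  the new atom is true, its source being unmoved as \<open>v \<noteq> w\<close>. Only
  \<open>Lab v \<phi>\<close> is left to satisfy the premise.\<close>

lemma satisfied_eigenvariable:
  assumes premise: "\<And>J. range J \<subseteq> worlds M \<Longrightarrow>
      satisfied M J (\<Gamma> + {#Rel \<alpha> w v, Lab v \<phi>#})"
    and fresh: "v \<notin> labels \<Gamma>" "v \<noteq> w" and I: "range I \<subseteq> worlds M"
    and unsat: "\<not> satisfied M I \<Gamma>" and b: "(I w, b) \<in> rel_of M \<alpha>"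
  shows "sat M b \<phi>"
proof -
  have "range (I(v := b)) \<subseteq> worlds M"
    using I rel_of_worlds[OF b] by auto
  from premise[OF this] show ?thesis
    using fresh unsat b by (simp add: satisfied_fun_upd)
qed

text \<open>The box atoms enter only through membership in \<open>\<Gamma>\<close>, so the plain and
  the contracted form of the rule are both instances.\<close>

lemma satisfied_IOA:
  assumes premise: "\<And>J. range J \<subseteq> worlds M \<Longrightarrow>
      satisfied M J (\<Gamma> + {#Rel (IAg i) (u i) v. i \<in># mset_set UNIV#})"
    and fresh: "v \<notin> labels \<Gamma>" and atoms: "\<And>i. Rel IBox w (u i) \<in># \<Gamma>"
    and I: "range I \<subseteq> worlds M"
  shows "satisfied M I \<Gamma>"
proof (rule ccontr)
  assume unsat: "\<not> satisfied M I \<Gamma>"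
  \<comment> \<open>An unsatisfied sequent has only true relational atoms.\<close>
  then have "(I w, I (u i)) \<in> Rbox M" for i
    using atoms[of i] by (auto simp: satisfied_iff)
  then obtain b where b: "b \<in> worlds M" "\<And>i. (I (u i), b) \<in> Rag M i"
    using independence_of_agents[of "I w" "\<lambda>i. I (u i)"] by blast
  \<comment> \<open>Each \<open>u i\<close> occurs in \<open>\<Gamma>\<close>, so sending
    \<open>v\<close> to \<open>b\<close> leaves it in place and makes all the added atoms
    true.\<close>
  have "u i \<noteq> v" for i
    using fresh atoms[of i] by (force simp: labels_def)
  moreover have "range (I(v := b)) \<subseteq> worlds M"
    using I b(1) by auto
  ultimately show False
    using premise[of "I(v := b)"] b(2) fresh unsat by (auto simp: satisfied_fun_upd)
qed

lemma G3Ldm_sound: "G3Ldm \<Gamma> \<Longrightarrow> range I \<subseteq> worlds M \<Longrightarrow> satisfied M I \<Gamma>"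
\<comment> \<open>Eigenvariable rules use the induction hypothesis at a modified
  interpretation.\<close>
proof (induction arbitrary: I rule: G3Ldm.induct)
  case (conj \<Gamma> w \<phi> \<psi>)
  then show ?case by fastforce
next
  case (disj \<Gamma> w \<phi> \<psi>)
  then show ?case by fastforce
next
  case (box \<Gamma> w v \<phi>)
  \<comment> \<open>The context passed on is the whole conclusion: it fails, it avoids
    \<open>v\<close>, and the premise survives weakening by the principal formula.\<close>
  let ?\<Delta> = "\<Gamma> + {#Lab w (Box \<phi>)#}"
  show ?case
  proof (rule ccontr)
    assume unsat: "\<not> satisfied M I ?\<Delta>"
    have "sat M b \<phi>" if "(I w, b) \<in> rel_of M IBox" for b
    proof (rule satisfied_eigenvariable[OF _ _ _ box.prems unsat that])
      show "v \<notin> labels ?\<Delta>" "v \<noteq> w"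
        using box.hyps(2) by (auto simp: labels_def)
      show "satisfied M J (?\<Delta> + {#Rel IBox w v, Lab v \<phi>#})" if "range J \<subseteq> worlds M" for J
        using box.IH[OF that] by auto
    qed
    with unsat show False by simp
  qed
next
  case (ag_box \<Gamma> i w v \<phi>)
  let ?\<Delta> = "\<Gamma> + {#Lab w (AgBox i \<phi>)#}"
  show ?case
  proof (rule ccontr)
    assume unsat: "\<not> satisfied M I ?\<Delta>"
    have "sat M b \<phi>" if "(I w, b) \<in> rel_of M (IAg i)" for b
    proof (rule satisfied_eigenvariable[OF _ _ _ ag_box.prems unsat that])
      show "v \<notin> labels ?\<Delta>" "v \<noteq> w"
        using ag_box.hyps(2) by (auto simp: labels_def)
      show "satisfied M J (?\<Delta> + {#Rel (IAg i) w v, Lab v \<phi>#})" if "range J \<subseteq> worlds M" for J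
        using ag_box.IH[OF that] by auto
    qed
    with unsat show False by simp
  qed
next
  case (IOA w u v \<Gamma>)
  let ?\<Delta> = "{#Rel IBox w (u i). i \<in># mset_set UNIV#} + \<Gamma>"
  show ?case
  proof (rule satisfied_IOA[OF _ IOA.hyps(2) _ IOA.prems])
    show "satisfied M J (?\<Delta> + {#Rel (IAg i) (u i) v. i \<in># mset_set UNIV#})"
      if "range J \<subseteq> worlds M" for J
      using IOA.IH[OF that] by (simp only: satisfied_union) blast
  qed auto
next
  case (IOA_contr w u v \<Gamma>)
  let ?\<Delta> = "mset_set (range (\<lambda>i. Rel IBox w (u i))) + \<Gamma>"
  show ?case
  proof (rule satisfied_IOA[OF _ IOA_contr.hyps(2) _ IOA_contr.prems])
    show "satisfied M J (?\<Delta> + {#Rel (IAg i) (u i) v. i \<in># mset_set UNIV#})"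
      if "range J \<subseteq> worlds M" for J
      using IOA_contr.IH[OF that] by (simp only: satisfied_union) blast
  qed auto
next
  case (dia \<Gamma> w u \<phi>)
  \<comment> \<open>If the added \<open>Lab u \<phi>\<close> holds, then either the atom is false or
    \<open>u\<close> witnesses the diamond.\<close>
  show ?case using dia.IH[OF dia.prems]  by auto
next
  case (ag_dia \<Gamma> i w u \<phi>)
  show ?case using ag_dia.IH[OF ag_dia.prems]  by auto
next
  case (refl_box w \<Gamma>)
  \<comment> \<open>Reflexivity holds only on \<open>worlds M\<close>; the range of \<open>I\<close>
    places \<open>I w\<close> there.\<close>
  show ?case using refl_box.IH[OF refl_box.prems] refl_box.prems rel_of_refl[of "I w" IBox] by auto
next
  case (refl_ag i w \<Gamma>)
  show ?case using refl_ag.IH[OF refl_ag.prems] refl_ag.prems rel_of_refl[of "I w" "IAg i"] by auto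
next
  case (eucl_box w u v \<Gamma>)
  show ?case using eucl_box.IH[OF eucl_box.prems] rel_of_eucl[of "I w" "I u" IBox "I v"] by auto
next
  case (eucl_box_contr w u \<Gamma>)
  show ?case using eucl_box_contr.IH[OF eucl_box_contr.prems]
      rel_of_eucl[of "I w" "I u" IBox "I u"] by auto
next
  case (br w u i \<Gamma>)
  \<comment> \<open>Choice cells lie within moments, so a false box atom makes the agent atom
    false.\<close>
  show ?case using br.IH[OF br.prems] C1[of i] by auto
next
  case (eucl_ag i w u v \<Gamma>)
  show ?case using eucl_ag.IH[OF eucl_ag.prems] rel_of_eucl[of "I w" "I u" "IAg i" "I v"] by auto
next
  case (eucl_ag_contr i w u \<Gamma>)
  show ?case using eucl_ag_contr.IH[OF eucl_ag_contr.prems]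
      rel_of_eucl[of "I w" "I u" "IAg i" "I u"] by auto
qed auto

end

theorem theorem3:
  fixes \<Gamma> :: "('l::countable, 'v::countable, 'ag::finite) sequent"
  assumes "G3Ldm \<Gamma>"
  shows "valid TYPE('w) \<Gamma>"
  using assms by (auto simp: valid_def intro!: tstit_model.G3Ldm_sound)

end
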